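(* Let $p>3$ be a prime and $m,x\in\mathbb Z_p$ with $m\not\equiv0,\pm1\pmod p$. Then $$\sum_{n=0}^{p-1}\frac{V_n(x)}{m^n}\equiv\Big(\sum_{k=0}^{p-1}\frac{G_k(x)}{m^k}\Big)^2\equiv\sum_{k=0}^{p-1}\frac{\binom{2k}k\binom xk\binom{-1-x}k}{(2-m-1/m)^k}\pmod p.$$ Consequently, for $m\in\mathbb Z_p$, $m\not\equiv0\pmod p$: $\sum_{n=0}^{p-1}\frac{V_n^{(3)}}{m^n}\equiv\big(\sum_{k=0}^{p-1}\frac{G_k^{(3)}}{m^k}\big)^2\equiv\sum_{k=0}^{p-1}\frac{\binom{2k}k^2\binom{3k}k}{(54-m-729/m)^k}\pmod p$ for $m\not\equiv\pm27\pmod p$; $\sum_{n=0}^{p-1}\frac{V_n^{(4)}}{m^n}\equiv\big(\sum_{k=0}^{p-1}\frac{G_k^{(4)}}{m^k}\big)^2\equiv\sum_{k=0}^{p-1}\frac{\binom{2k}k^2\binom{4k}{2k}}{(128-m-4096/m)^k}\pmod p$ for $m\not\equiv\pm64\pmod p$; $\sum_{n=0}^{p-1}\frac{V_n^{(6)}}{m^n}\equiv\big(\sum_{k=0}^{p-1}\frac{G_k^{(6)}}{m^k}\big)^2\equiv\sum_{k=0}^{p-1}\frac{\binom{2k}k\binom{3k}k\binom{6k}{3k}}{(864-m-186624/m)^k}\pmod p$ for $m\not\equiv\pm432\pmod p$.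
   Context: For real $x$ and integer $k\ge0$, $\binom xk=x(x-1)\cdots(x-k+1)/k!$. $G_n(x)=\sum_{k=0}^n\binom nk(-1)^k\binom xk\binom{-1-x}k$, $V_n(x)=\sum_{k=0}^n\binom nk\binom{n+k}k(-1)^k\binom xk\binom{-1-x}k$. $\mathbb Z_p$: rationals with denominator prime to $p$; congruences mod $p$ are in $\mathbb Z_p$. $G_n^{(r)}=c_r^nG_n(-1/r)$ and $V_n^{(r)}=c_r^nV_n(-1/r)$ for $(r,c_r)=(3,27),(4,64),(6,432)$. *)

theory Defs
  imports Complex_Main "HOL-Computational_Algebra.Primes"
begin

(* Rationals with denominator prime to p.  The fraction a / b need not be in lowest terms;
   for prime p this is the same set. *)
definition Zp :: "nat \<Rightarrow> rat set" where
  "Zp p = {x. \<exists>a b :: int. coprime b (int p) \<and> b \<noteq> 0 \<and> x = of_int a / of_int b}"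

(* Congruence in the ring Zp p modulo the ideal p * Zp p.  Both sides are required to be
   elements of Zp p, so asserting a congruence also asserts p-integrality of both sides. *)
definition cong_Zp :: "nat \<Rightarrow> rat \<Rightarrow> rat \<Rightarrow> bool" where
  "cong_Zp p a b \<longleftrightarrow> a \<in> Zp p \<and> b \<in> Zp p \<and> (\<exists>c \<in> Zp p. a - b = of_nat p * c)"

definition G :: "nat \<Rightarrow> rat \<Rightarrow> rat" where
  "G n x = (\<Sum>k=0..n. of_nat (n choose k) * (-1) ^ k * (x gchoose k) * ((-1 - x) gchoose k))"

definition V :: "nat \<Rightarrow> rat \<Rightarrow> rat" where
  "V n x = (\<Sum>k=0..n. of_nat (n choose k) * of_nat ((n + k) choose k) * (-1) ^ k
              * (x gchoose k) * ((-1 - x) gchoose k))"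

(* Only the values at r = 3, 4, 6 are meaningful. *)
definition c_of :: "nat \<Rightarrow> rat" where
  "c_of r = (if r = 3 then 27 else if r = 4 then 64 else if r = 6 then 432 else undefined)"

definition Gr :: "nat \<Rightarrow> nat \<Rightarrow> rat" where
  "Gr r n = c_of r ^ n * G n (- 1 / of_nat r)"

definition Vr :: "nat \<Rightarrow> nat \<Rightarrow> rat" where
  "Vr r n = c_of r ^ n * V n (- 1 / of_nat r)"

end

(* Put A_k = (-1)^k C(x,k) C(-1-x,k), z = 1/m and w = z/(1-z) = 1/(m-1).  Interchanging sums and
   using the truncated negative binomial series modulo p (a finite binomial sum, because
   -l-1 = p-1-l mod p, followed by Fermat's little theorem) gives, modulo p,
     sum G_n(x) z^n = sum A_k w^k   and   sum V_n(x) z^n = sum C(2k,k) A_k (w(1+w))^k,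
   and w(1+w) = -1/(2-m-1/m).  Replacing x by a natural number t < p congruent to it turns A_k into
   C(t,k) C(t+k,k), and the two sums into polynomials related by Clausen's identity
     (sum C(t,k) C(t+k,k) w^k)^2 = sum C(2k,k) C(t,k) C(t+k,k) (w(1+w))^k.
   Both sides of the latter solve the symmetric square of the Legendre equation, whose polynomial
   solutions are determined by their value at 0. *)
theory Submission
  imports Defs "HOL-Number_Theory.Residues" "HOL-Computational_Algebra.Polynomial"
begin

section \<open>Differential equations for polynomials over the rationals\<close>

section \<open>Clausen's identity for Legendre polynomials\<close>

text \<open>The coefficient of w^k in the Legendre polynomial P_n(1 + 2w).\<close>

definition legendre_coeff :: "nat \<Rightarrow> nat \<Rightarrow> rat" where
  "legendre_coeff n k = of_nat (n choose k) * of_nat ((n + k) choose k)"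

lemma legendre_coeff_0 [simp]: "legendre_coeff n 0 = 1"
  by (simp add: legendre_coeff_def)

text \<open>The two binomials gain the factors (n - k)/(k + 1) and (n + k + 1)/(k + 1), and (n -
  k)(n + k + 1) = n(n + 1) - k(k + 1). In this form the recurrence is the Legendre equation with c =
  n(n + 1), read off coefficientwise.\<close>

lemma legendre_coeff_Suc:
  "of_nat (Suc k) ^ 2 * legendre_coeff n (Suc k)
     = (of_nat n * (of_nat n + 1) - of_nat k * (of_nat k + 1)) * legendre_coeff n k"
proof -
  have 1: "of_nat (Suc k) * rat_of_nat (n choose Suc k) = (of_nat n - of_nat k) * of_nat (n choose k)"
  \<comment> \<open>Natural subtraction truncates, so the transfer to rationals needs
    \<open>k \<le> n\<close>; for larger \<open>k\<close> both binomials vanish.\<close>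
  proof (cases "k \<le> n")
    case True
    have "Suc k * (n choose Suc k) = (n - k) * (n choose k)"
      using binomial_absorb_comp[of n k] binomial_absorption[of k n] by simp
    then have "rat_of_nat (Suc k * (n choose Suc k)) = of_nat ((n - k) * (n choose k))"
      by (rule arg_cong)
    then show ?thesis using True by (simp only: of_nat_mult of_nat_diff)
  qed (simp add: binomial_eq_0)
  have "Suc k * ((n + Suc k) choose Suc k) = (n + Suc k) * ((n + k) choose k)"
    using Suc_times_binomial_eq[of "n + k" k] by (simp add: mult.commute)
  then have "rat_of_nat (Suc k * ((n + Suc k) choose Suc k)) = of_nat ((n + Suc k) * ((n + k) choose k))"
    by (rule arg_cong)
  then have 2: "of_nat (Suc k) * rat_of_nat ((n + Suc k) choose Suc k)
      = (of_nat n + of_nat k + 1) * of_nat ((n + k) choose k)"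
    by (simp add: algebra_simps)
  have "of_nat (Suc k) ^ 2 * legendre_coeff n (Suc k)
     = (of_nat (Suc k) * rat_of_nat (n choose Suc k)) * (of_nat (Suc k) * of_nat ((n + Suc k) choose Suc k))"
    by (simp only: legendre_coeff_def power2_eq_square mult_ac)
  also have "\<dots> = (of_nat n * (of_nat n + 1) - of_nat k * (of_nat k + 1)) * legendre_coeff n k"
    unfolding 1 2 legendre_coeff_def by (simp add: algebra_simps)
  finally show ?thesis .
qed

text \<open>Pascal's rule and symmetry give C(2k+2, k+1) = 2 C(2k+1, k+1), and absorption does the
  rest. This is the extra factor in the recurrence for the right side of Clausen's identity.\<close>

lemma central_binomial_Suc:
  "of_nat (Suc k) * rat_of_nat ((2 * Suc k) choose Suc k)
     = 2 * (2 * of_nat k + 1) * of_nat ((2 * k) choose k)"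
proof -
  have 1: "Suc k * (Suc (2 * k) choose Suc k) = (2 * k + 1) * ((2 * k) choose k)"
    using Suc_times_binomial_eq[of "2 * k" k] by (simp add: mult.commute)
  have "(2 * Suc k) choose Suc k = 2 * (Suc (2 * k) choose Suc k)"
    using binomial_symmetric[of k "Suc (2 * k)"] by simp
  then have "Suc k * ((2 * Suc k) choose Suc k) = 2 * ((2 * k + 1) * ((2 * k) choose k))"
    using 1 by (simp only: mult.left_commute)
  from arg_cong[OF this, of rat_of_nat] show ?thesis
    by (simp only: of_nat_mult of_nat_add of_nat_1 of_nat_numeral mult_ac)
qed

text \<open>With \<open>Y = w(1+w)\<close>, the symmetric square of the Legendre equation \<open>(Y A')' = c A\<close> is
  \<open>(Y T)' = 2c Y S'\<close> where \<open>T = (Y S')' - 2c S\<close>; for \<open>S = A\<^sup>2\<close> one has \<open>T = 2 Y A'\<^sup>2\<close>.\<close>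

definition clausen_inner :: "rat \<Rightarrow> rat poly \<Rightarrow> rat poly" where
  "clausen_inner c S = [:0, 1, 1:] * pderiv (pderiv S) + [:1, 2:] * pderiv S - smult (2 * c) S"

definition clausen_op :: "rat \<Rightarrow> rat poly \<Rightarrow> rat poly" where
  "clausen_op c S = pderiv ([:0, 1, 1:] * clausen_inner c S) - smult (2 * c) ([:0, 1, 1:] * pderiv S)"

lemma coeff_Y_mult: "coeff ([:0, 1, 1:] * q) k
   = (case k of 0 \<Rightarrow> 0 | Suc j \<Rightarrow> coeff q j + (case j of 0 \<Rightarrow> 0 | Suc i \<Rightarrow> coeff q i))"
  for q :: "rat poly"
  by (simp add: coeff_pCons split: nat.split)

lemma coeff_clausen_inner: "coeff (clausen_inner c S) k
   = of_nat (Suc k) ^ 2 * coeff S (Suc k) + (of_nat k * (of_nat k + 1) - 2 * c) * coeff S k"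
  unfolding clausen_inner_def
  by (cases k; cases "k - 1")
     (auto simp: coeff_pderiv coeff_pCons algebra_simps power2_eq_square split: nat.split)

lemma coeff_clausen_op: "coeff (clausen_op c S) (Suc k)
   = of_nat (Suc (Suc k)) * (coeff (clausen_inner c S) (Suc k) + coeff (clausen_inner c S) k)
     - 2 * c * (of_nat (Suc k) * coeff S (Suc k) + of_nat k * coeff S k)"
  "coeff (clausen_op c S) 0 = coeff (clausen_inner c S) 0"
  unfolding clausen_op_def
  by (cases k; simp add: coeff_pderiv coeff_Y_mult)+

text \<open>In degree k + 1 of the equation the coefficient of w^(k+2) in \<open>S\<close> has the
  factor (k + 2)^3, nonzero in characteristic 0, so the constant term determines all others in turn.
  The recurrence has three terms, hence the induction carries two consecutive coefficients.\<close>

lemma clausen_op_unique: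
  assumes "clausen_op c S = 0" "coeff S 0 = 0"
  shows "S = 0"
proof -
  have "coeff S k = 0 \<and> coeff S (Suc k) = 0" for k
  proof (induction k)
    case 0
    have "coeff (clausen_op c S) 0 = 0" by (simp add: assms)
    then have "coeff S (Suc 0) = 0" by (simp add: coeff_clausen_op coeff_clausen_inner assms(2))
    then show ?case using assms(2) by simp
  next
    case (Suc k)
    have "coeff (clausen_op c S) (Suc k) = 0" by (simp add: assms)
    then show ?case using Suc by (simp add: coeff_clausen_op coeff_clausen_inner del: of_nat_Suc)
  qed
  then show ?thesis by (intro poly_eqI) simp
qed

lemma clausen_op_diff: "clausen_op c (S - S') = clausen_op c S - clausen_op c S'"
proof (rule poly_eqI)
  show "coeff (clausen_op c (S - S')) k = coeff (clausen_op c S - clausen_op c S') k" for k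
    by (cases k) (simp_all add: coeff_clausen_op coeff_clausen_inner algebra_simps)
qed

text \<open>The hypothesis reads (Y A')' = c A. Since T = 2 Y A'^2, one has Y T = 2 (Y A')^2, whose
  derivative is 4 (Y A') c A = 2c Y (A^2)'.\<close>

lemma clausen_op_square:
  assumes ode: "[:0, 1, 1:] * pderiv (pderiv A) + [:1, 2:] * pderiv A = smult c A"
  shows "clausen_op c (A ^ 2) = 0"
proof -
  define Y :: "rat poly" where "Y = [:0, 1, 1:]"
  define u :: "rat poly" where "u = [:1, 2:]"
  define a where "a = pderiv A"
  \<comment> \<open>A constant polynomial in place of \<open>smult\<close> turns the remaining
    claims into plain ring identities.\<close>
  define C where "C = [:c:]"
  have sm: "smult c q = C * q" for q by (simp add: C_def)
  have sm2: "smult (2 * c) q = 2 * C * q" for q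
    by (simp only: mult_2 distrib_right smult_add_left sm)
  have dY: "pderiv Y = u" by (simp add: Y_def u_def pderiv_pCons)
  have ode': "Y * pderiv a = C * A - u * a"
    using ode unfolding Y_def[symmetric] u_def[symmetric] a_def sm by (simp add: algebra_simps)
  have S1: "pderiv (A ^ 2) = 2 * A * a"
    by (simp add: power2_eq_square pderiv_mult a_def)
  have S2: "pderiv (2 * A * a) = 2 * a * a + 2 * A * pderiv a"
    by (simp add: pderiv_mult a_def algebra_simps)
  have "clausen_inner c (A ^ 2) = 2 * Y * a * a + 2 * A * (Y * pderiv a) + u * (2 * A * a) - 2 * C * A ^ 2"
    unfolding clausen_inner_def S1 S2 sm2 by (fold Y_def u_def) (simp add: algebra_simps)
  also have "\<dots> = 2 * Y * a * a"
    unfolding ode' by (simp add: algebra_simps power2_eq_square)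
  finally have T: "clausen_inner c (A ^ 2) = 2 * Y * a * a" .
  have "pderiv (Y * (2 * Y * a * a)) = 4 * Y * u * a * a + 4 * Y * a * (Y * pderiv a)"
    by (simp add: pderiv_mult dY algebra_simps)
  then show ?thesis
    unfolding clausen_op_def T S1 sm2 Y_def[symmetric] ode' by (simp add: algebra_simps)
qed

text \<open>In the variable y = Y(w), the chain rule and Y'^2 = 1 + 4Y turn the equation for B(Y)
  into (y \<open>\<tau>\<close>)' = 2c y B', which is the assumed recurrence coefficient by
  coefficient.\<close>

lemma clausen_op_pcompose:
  assumes rec: "\<And>k. of_nat (Suc k) ^ 3 * coeff B (Suc k)
     = 2 * (2 * of_nat k + 1) * (c - of_nat k * (of_nat k + 1)) * coeff B k"
  shows "clausen_op c (B \<circ>\<^sub>p [:0, 1, 1:]) = 0"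
proof -
  define Y :: "rat poly" where "Y = [:0, 1, 1:]"
  define u :: "rat poly" where "u = [:1, 2:]"
  define S where "S = B \<circ>\<^sub>p Y"
  \<comment> \<open>This is \<open>clausen_inner\<close> written in y: the coefficients come from Y
    u^2 = Y + 4Y^2 and 2Y + u^2 = 1 + 6Y.\<close>
  define \<tau> where "\<tau> = [:0, 1, 4:] * pderiv (pderiv B) + [:1, 6:] * pderiv B - smult (2 * c) B"
  have dY: "pderiv Y = u" and du: "pderiv u = 2" and uu: "u * u = 1 + 4 * Y"
    by (simp_all add: Y_def u_def pderiv_pCons one_pCons numeral_poly)
  have S1: "pderiv S = (pderiv B \<circ>\<^sub>p Y) * u"
    by (simp add: S_def pderiv_pcompose dY)
  have S2: "pderiv (pderiv S) = (pderiv (pderiv B) \<circ>\<^sub>p Y) * (u * u) + 2 * (pderiv B \<circ>\<^sub>p Y)"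
    unfolding S1 by (simp add: pderiv_mult pderiv_pcompose dY du algebra_simps)
  have c1: "[:0, 1, 4:] \<circ>\<^sub>p Y = Y * (1 + 4 * Y)" "[:1, 6:] \<circ>\<^sub>p Y = 1 + 6 * Y"
    by (simp_all add: pcompose_pCons Y_def one_pCons numeral_poly)
  have T: "clausen_inner c S = \<tau> \<circ>\<^sub>p Y"
  proof -
    define P0 where "P0 = B \<circ>\<^sub>p Y"
    define P1 where "P1 = pderiv B \<circ>\<^sub>p Y"
    define P2 where "P2 = pderiv (pderiv B) \<circ>\<^sub>p Y"
    have "clausen_inner c S = Y * (P2 * (u * u) + 2 * P1) + P1 * (u * u) - smult (2 * c) P0"
      unfolding clausen_inner_def Y_def[symmetric] u_def[symmetric] S2
      unfolding S1 by (simp only: S_def P0_def P1_def P2_def mult_ac)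
    also have "\<dots> = Y * (1 + 4 * Y) * P2 + (1 + 6 * Y) * P1 - smult (2 * c) P0"
      unfolding uu by (simp add: algebra_simps)
    also have "\<dots> = \<tau> \<circ>\<^sub>p Y"
      unfolding \<tau>_def P0_def P1_def P2_def
      by (simp only: pcompose_add pcompose_diff pcompose_mult pcompose_smult c1)
    finally show ?thesis .
  qed
  have "pderiv ([:0, 1:] * \<tau>) = smult (2 * c) ([:0, 1:] * pderiv B)"
  proof (rule poly_eqI)
    fix k
    have 1: "coeff \<tau> k = of_nat (Suc k) ^ 2 * coeff B (Suc k)
        + (2 * of_nat k * (2 * of_nat k + 1) - 2 * c) * coeff B k"
      unfolding \<tau>_def
      by (cases k; cases "k - 1")
         (auto simp: coeff_pderiv coeff_pCons algebra_simps power2_eq_square split: nat.split)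
    have "coeff (pderiv ([:0, 1:] * \<tau>)) k = of_nat (Suc k) * coeff \<tau> k"
      by (simp add: coeff_pderiv)
    also have "\<dots> = of_nat (Suc k) ^ 3 * coeff B (Suc k)
        + of_nat (Suc k) * (2 * of_nat k * (2 * of_nat k + 1) - 2 * c) * coeff B k"
      unfolding 1 by (simp add: algebra_simps power2_eq_square power3_eq_cube del: of_nat_Suc)
    also have "\<dots> = 2 * c * (of_nat k * coeff B k)"
      unfolding rec by (simp add: algebra_simps)
    also have "\<dots> = coeff (smult (2 * c) ([:0, 1:] * pderiv B)) k"
      by (cases k) (simp_all add: coeff_pderiv)
    finally show "coeff (pderiv ([:0, 1:] * \<tau>)) k = coeff (smult (2 * c) ([:0, 1:] * pderiv B)) k" .
  qed
  \<comment> \<open>Composing with Y and multiplying by u = Y' turns the derivative in y into the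
    derivative in w.\<close>
  from arg_cong[OF this, of "\<lambda>q. (q \<circ>\<^sub>p Y) * u"]
  have "pderiv (([:0, 1:] * \<tau>) \<circ>\<^sub>p Y) = smult (2 * c) (Y * pderiv S)"
    by (simp add: pderiv_pcompose[of _ Y] dY S1 pcompose_smult pcompose_mult[of "[:0, 1:]" "pderiv B"]
        pcompose_pCons mult.assoc del: mult_pCons_left)
  then show ?thesis
    unfolding clausen_op_def S_def[symmetric] Y_def[symmetric] T
    by (simp add: pcompose_mult pcompose_pCons del: mult_pCons_left)
qed

theorem legendre_clausen:
  fixes w :: rat
  shows "(\<Sum>k\<le>n. legendre_coeff n k * w ^ k) ^ 2
    = (\<Sum>k\<le>n. of_nat ((2 * k) choose k) * legendre_coeff n k * (w * (1 + w)) ^ k)"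
proof -
  define c :: rat where "c = of_nat n * (of_nat n + 1)"
  define A where "A = (\<Sum>k\<le>n. monom (legendre_coeff n k) k)"
  define B where "B = (\<Sum>k\<le>n. monom (of_nat ((2 * k) choose k) * legendre_coeff n k) k)"
  have leg0: "legendre_coeff n k = 0" if "k > n" for k
    using that by (simp add: legendre_coeff_def)
  have A: "coeff A k = legendre_coeff n k" for k
    by (simp add: A_def coeff_sum leg0)
  have B: "coeff B k = of_nat ((2 * k) choose k) * legendre_coeff n k" for k
    by (simp add: B_def coeff_sum leg0)
  have "[:0, 1, 1:] * pderiv (pderiv A) + [:1, 2:] * pderiv A = smult c A"
  proof (rule poly_eqI)
    fix k
    have "coeff ([:0, 1, 1:] * pderiv (pderiv A) + [:1, 2:] * pderiv A) k
        = of_nat (Suc k) ^ 2 * coeff A (Suc k) + of_nat k * (of_nat k + 1) * coeff A k"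
      by (cases k; cases "k - 1")
         (auto simp: coeff_pderiv coeff_pCons algebra_simps power2_eq_square split: nat.split)
    also have "\<dots> = coeff (smult c A) k"
      unfolding A legendre_coeff_Suc c_def by (simp add: A algebra_simps)
    finally show "coeff ([:0, 1, 1:] * pderiv (pderiv A) + [:1, 2:] * pderiv A) k = coeff (smult c A) k" .
  qed
  then have 1: "clausen_op c (A ^ 2) = 0"
    by (rule clausen_op_square)
  have 2: "clausen_op c (B \<circ>\<^sub>p [:0, 1, 1:]) = 0"
  proof (rule clausen_op_pcompose)
    fix k
    have "of_nat (Suc k) ^ 3 * coeff B (Suc k)
        = (of_nat (Suc k) * of_nat ((2 * Suc k) choose Suc k)) * (of_nat (Suc k) ^ 2 * legendre_coeff n (Suc k))"
      unfolding B by (simp only: power3_eq_cube power2_eq_square mult_ac)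
    also have "\<dots> = 2 * (2 * of_nat k + 1) * (c - of_nat k * (of_nat k + 1)) * coeff B k"
      unfolding central_binomial_Suc legendre_coeff_Suc B c_def by (simp only: mult_ac)
    finally show "of_nat (Suc k) ^ 3 * coeff B (Suc k)
        = 2 * (2 * of_nat k + 1) * (c - of_nat k * (of_nat k + 1)) * coeff B k" .
  qed
  have "A ^ 2 - B \<circ>\<^sub>p [:0, 1, 1:] = 0"
  proof (rule clausen_op_unique)
    show "clausen_op c (A ^ 2 - B \<circ>\<^sub>p [:0, 1, 1:]) = 0"
      by (simp add: clausen_op_diff 1 2)
    \<comment> \<open>Y vanishes at 0, so the constant terms are compared by evaluating
      there.\<close>
    have "coeff A 0 = 1" "coeff B 0 = 1"
      by (simp_all add: A B)
    then have "poly A 0 = 1" "poly B 0 = 1"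
      by (simp_all add: poly_0_coeff_0)
    then have "poly (A ^ 2 - B \<circ>\<^sub>p [:0, 1, 1:]) 0 = 0"
      by (simp add: poly_pcompose)
    then show "coeff (A ^ 2 - B \<circ>\<^sub>p [:0, 1, 1:]) 0 = 0"
      by (simp only: poly_0_coeff_0)
  qed
  then have "poly A w ^ 2 = poly B (w * (1 + w))"
    using poly_pcompose[of B "[:0, 1, 1:]" w] poly_power[of A 2 w] by simp
  then show ?thesis
    by (simp only: A_def B_def poly_sum poly_monom)
qed

section \<open>Interchange of sums, and closed forms of products of two generalized
  binomials\<close>

section \<open>Binomial products\<close>

text \<open>As n choose k is 0 for k > n, the inner sum may run up to \<open>N\<close> before the
  swap. The factor \<open>h\<close> is 1 for \<open>G\<close> and (n + k) choose k for
  \<open>V\<close>.\<close>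

lemma sum_binomial_transform:
  fixes z :: rat
  shows "(\<Sum>n = 0..N. (\<Sum>k = 0..n. of_nat (n choose k) * h n k * f k) * z ^ n)
    = (\<Sum>k = 0..N. f k * (\<Sum>n = 0..N. of_nat (n choose k) * h n k * z ^ n))"
proof -
  have "(\<Sum>n = 0..N. (\<Sum>k = 0..n. of_nat (n choose k) * h n k * f k) * z ^ n)
      = (\<Sum>n = 0..N. \<Sum>k = 0..N. of_nat (n choose k) * h n k * f k * z ^ n)"
    unfolding sum_distrib_right by (intro sum.cong refl sum.mono_neutral_left) auto
  also have "\<dots> = (\<Sum>k = 0..N. \<Sum>n = 0..N. of_nat (n choose k) * h n k * f k * z ^ n)"
    by (rule sum.swap)
  also have "\<dots> = (\<Sum>k = 0..N. f k * (\<Sum>n = 0..N. of_nat (n choose k) * h n k * z ^ n))"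
    by (simp add: sum_distrib_left mult_ac)
  finally show ?thesis .
qed

text \<open>Upper negation: the right side is a polynomial in \<open>t\<close>, so it can be
  compared with its value at a rational congruent to \<open>t\<close>.\<close>

lemma choose_add_eq_gchoose:
  "rat_of_nat ((t + k) choose k) = (- 1) ^ k * ((- 1 - of_nat t) gchoose k)"
  using gbinomial_negated_upper[of "rat_of_nat (t + k)" k]
  by (simp add: binomial_gbinomial minus_diff_commute)

lemma legendre_coeff_eq_gchoose: "legendre_coeff t k = (- 1) ^ k * (of_nat t gchoose k) * ((- 1 - of_nat t) gchoose k)"
  by (simp add: legendre_coeff_def choose_add_eq_gchoose)
     (simp add: binomial_gbinomial)

text \<open>Both sides start at 1 and have the same term ratio, because (x - k)(-1 - x - k) = (k -
  x)(k + 1 + x).\<close>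

lemma gchoose_product_eqI:
  fixes x c :: rat
  assumes "F 0 = 1"
    and "\<And>k. F (Suc k) = c * (of_nat k - x) * (of_nat k + 1 + x) / of_nat (Suc k) ^ 2 * F k"
  shows "c ^ k * (x gchoose k) * ((- 1 - x) gchoose k) = F k"
proof (induction k)
  case (Suc k)
  have rec: "a gchoose Suc k = (a - of_nat k) / of_nat (Suc k) * (a gchoose k)" for a :: rat
    using gbinomial_mult_1[of a k] by (simp add: field_simps)
  have "c ^ Suc k * (x gchoose Suc k) * ((- 1 - x) gchoose Suc k)
      = c * ((x - of_nat k) / of_nat (Suc k)) * ((- 1 - x - of_nat k) / of_nat (Suc k)) *
        (c ^ k * (x gchoose k) * ((- 1 - x) gchoose k))"
    unfolding rec by (simp only: power_Suc mult_ac)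
  also have "c * ((x - of_nat k) / of_nat (Suc k)) * ((- 1 - x - of_nat k) / of_nat (Suc k))
      = c * (of_nat k - x) * (of_nat k + 1 + x) / of_nat (Suc k) ^ 2"
    by (simp add: power2_eq_square divide_simps del: of_nat_Suc) (simp add: algebra_simps)
  finally show ?case
    unfolding Suc.IH assms(2)[of k] .
qed (simp add: assms(1))

text \<open>Both sides are (3k)!/k!^3, with term ratio (3k+1)(3k+2)(3k+3)/(k+1)^3 = 27 (k + 1/3)(k +
  2/3)/(k+1)^2.\<close>

lemma gchoose_product_3:
  "27 ^ k * ((- 1 / 3) gchoose k) * ((- 1 - (- 1 / 3)) gchoose k)
    = rat_of_nat (((2 * k) choose k) * ((3 * k) choose k))"
proof -
  define F :: "nat \<Rightarrow> rat" where "F k = fact (3 * k) / fact k ^ 3" for k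
  have "27 ^ k * ((- 1 / 3) gchoose k) * ((- 1 - (- 1 / 3)) gchoose k) = F k"
  proof (rule gchoose_product_eqI)
    fix k
    have eq: "3 * Suc k = Suc (Suc (Suc (3 * k)))" by simp
    have "(fact (3 * Suc k) :: rat)
        = (3 * of_nat k + 3) * (3 * of_nat k + 2) * (3 * of_nat k + 1) * fact (3 * k)"
      unfolding eq fact_Suc by (simp add: add_ac mult_ac)
    then have "F (Suc k) = (3 * of_nat k + 3) * (3 * of_nat k + 2) * (3 * of_nat k + 1) /
        of_nat (Suc k) ^ 3 * F k"
      by (simp add: F_def power_mult_distrib)
    also have "(3 * rat_of_nat k + 3) * (3 * of_nat k + 2) * (3 * of_nat k + 1) / of_nat (Suc k) ^ 3
      = 27 * (of_nat k - (- 1 / 3)) * (of_nat k + 1 + (- 1 / 3)) / of_nat (Suc k) ^ 2"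
      by (simp add: divide_simps power2_eq_square power3_eq_cube) (simp add: algebra_simps)
    finally show "F (Suc k) = 27 * (of_nat k - (- 1 / 3)) * (of_nat k + 1 + (- 1 / 3))
        / of_nat (Suc k) ^ 2 * F k" .
  qed (simp add: F_def)
  also have "\<dots> = rat_of_nat (((2 * k) choose k) * ((3 * k) choose k))"
    by (simp add: F_def binomial_fact power3_eq_cube)
  finally show ?thesis .
qed

text \<open>Both sides are (4k)!/((2k)! k!^2); after cancellation the term ratio is
  4(4k+1)(4k+3)/(k+1)^2, and 4 * 4^2 = 64.\<close>

lemma gchoose_product_4:
  "64 ^ k * ((- 1 / 4) gchoose k) * ((- 1 - (- 1 / 4)) gchoose k)
    = rat_of_nat (((2 * k) choose k) * ((4 * k) choose (2 * k)))"
proof -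
  define F :: "nat \<Rightarrow> rat" where "F k = fact (4 * k) / (fact (2 * k) * fact k ^ 2)" for k
  have "64 ^ k * ((- 1 / 4) gchoose k) * ((- 1 - (- 1 / 4)) gchoose k) = F k"
  proof (rule gchoose_product_eqI)
    fix k
    have eq: "4 * Suc k = Suc (Suc (Suc (Suc (4 * k))))" "2 * Suc k = Suc (Suc (2 * k))"
      by simp_all
    have "(fact (4 * Suc k) :: rat) = (4 * of_nat k + 4) * (4 * of_nat k + 3) *
        (4 * of_nat k + 2) * (4 * of_nat k + 1) * fact (4 * k)"
      "(fact (2 * Suc k) :: rat) = (2 * of_nat k + 2) * (2 * of_nat k + 1) * fact (2 * k)"
      unfolding eq fact_Suc by (simp_all add: add_ac mult_ac)
    then have "F (Suc k) = (4 * of_nat k + 4) * (4 * of_nat k + 3) * (4 * of_nat k + 2) *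
        (4 * of_nat k + 1) / ((2 * of_nat k + 2) * (2 * of_nat k + 1) * of_nat (Suc k) ^ 2) * F k"
      by (simp add: F_def power_mult_distrib)
    also have "(4 * of_nat k + 4) * (4 * of_nat k + 3) * (4 * of_nat k + 2) *
        (4 * of_nat k + 1) / ((2 * of_nat k + 2) * (2 * of_nat k + 1) * of_nat (Suc k) ^ 2)
      = 64 * (rat_of_nat k - (- 1 / 4)) * (of_nat k + 1 + (- 1 / 4)) / of_nat (Suc k) ^ 2"
    proof -
      have "2 * rat_of_nat k + 2 \<noteq> 0" "2 * rat_of_nat k + 1 \<noteq> 0"
        by (simp_all add: add_nonneg_eq_0_iff)
      then show ?thesis
        by (simp add: divide_simps power2_eq_square) (simp add: algebra_simps)
    qed
    finally show "F (Suc k) = 64 * (of_nat k - (- 1 / 4)) * (of_nat k + 1 + (- 1 / 4))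
        / of_nat (Suc k) ^ 2 * F k" .
  qed (simp add: F_def)
  also have "\<dots> = rat_of_nat (((2 * k) choose k) * ((4 * k) choose (2 * k)))"
    by (simp add: F_def binomial_fact power2_eq_square)
  finally show ?thesis .
qed

text \<open>Both sides are (6k)!/((3k)! (2k)! k!); after cancellation the term ratio is
  12(6k+1)(6k+5)/(k+1)^2, and 12 * 6^2 = 432.\<close>

lemma gchoose_product_6:
  "432 ^ k * ((- 1 / 6) gchoose k) * ((- 1 - (- 1 / 6)) gchoose k)
    = rat_of_nat (((3 * k) choose k) * ((6 * k) choose (3 * k)))"
proof -
  define F :: "nat \<Rightarrow> rat" where "F k = fact (6 * k) / (fact (3 * k) * fact (2 * k) * fact k)" for k
  have "432 ^ k * ((- 1 / 6) gchoose k) * ((- 1 - (- 1 / 6)) gchoose k) = F k"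
  proof (rule gchoose_product_eqI)
    fix k
    have eq: "6 * Suc k = Suc (Suc (Suc (Suc (Suc (Suc (6 * k))))))" "2 * Suc k = Suc (Suc (2 * k))"
      "3 * Suc k = Suc (Suc (Suc (3 * k)))"
      by simp_all
    have facts: "(fact (6 * Suc k) :: rat) = (6 * of_nat k + 6) * ((6 * of_nat k + 5) *
        ((6 * of_nat k + 4) * ((6 * of_nat k + 3) * ((6 * of_nat k + 2) *
        ((6 * of_nat k + 1) * fact (6 * k))))))"
      "(fact (2 * Suc k) :: rat) = (2 * of_nat k + 2) * ((2 * of_nat k + 1) * fact (2 * k))"
      "(fact (3 * Suc k) :: rat) = (3 * of_nat k + 3) * ((3 * of_nat k + 2) *
        ((3 * of_nat k + 1) * fact (3 * k)))"
      unfolding eq fact_Suc by (simp_all add: add_ac)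
    then have "F (Suc k) = (6 * of_nat k + 6) * (6 * of_nat k + 5) * (6 * of_nat k + 4) *
        (6 * of_nat k + 3) * (6 * of_nat k + 2) * (6 * of_nat k + 1) /
        ((3 * of_nat k + 3) * (3 * of_nat k + 2) * (3 * of_nat k + 1) *
         ((2 * of_nat k + 2) * (2 * of_nat k + 1)) * of_nat (Suc k)) * F k"
      unfolding F_def facts fact_Suc[of k] by (simp only: times_divide_times_eq mult_ac)
    also have "(6 * of_nat k + 6) * (6 * of_nat k + 5) * (6 * of_nat k + 4) *
        (6 * of_nat k + 3) * (6 * of_nat k + 2) * (6 * of_nat k + 1) /
        ((3 * of_nat k + 3) * (3 * of_nat k + 2) * (3 * of_nat k + 1) *
         ((2 * of_nat k + 2) * (2 * of_nat k + 1)) * of_nat (Suc k))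
      = 432 * (rat_of_nat k - (- 1 / 6)) * (of_nat k + 1 + (- 1 / 6)) / of_nat (Suc k) ^ 2"
    proof -
      define y where "y = rat_of_nat k"
      have nz: "y + 1 \<noteq> 0" "3 * y + 2 \<noteq> 0" "3 * y + 1 \<noteq> 0" "2 * y + 1 \<noteq> 0"
        by (simp_all add: y_def add_nonneg_eq_0_iff)
      \<comment> \<open>Pulling out constants makes the denominator a product of factors shown
        nonzero in \<open>nz\<close>.\<close>
      have f: "6 * y + 6 = 6 * (y + 1)" "6 * y + 4 = 2 * (3 * y + 2)" "6 * y + 3 = 3 * (2 * y + 1)"
        "6 * y + 2 = 2 * (3 * y + 1)" "3 * y + 3 = 3 * (y + 1)" "2 * y + 2 = 2 * (y + 1)"
        "rat_of_nat (Suc k) = y + 1"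
        by (simp_all add: y_def)
      show ?thesis
        unfolding y_def[symmetric] unfolding f using nz
        by (simp add: divide_simps power2_eq_square) (simp add: algebra_simps)
    qed
    finally show "F (Suc k) = 432 * (of_nat k - (- 1 / 6)) * (of_nat k + 1 + (- 1 / 6))
        / of_nat (Suc k) ^ 2 * F k" .
  qed (simp add: F_def)
  also have "\<dots> = rat_of_nat (((3 * k) choose k) * ((6 * k) choose (3 * k)))"
    by (simp add: F_def binomial_fact)
  finally show ?thesis .
qed

lemma sum_atMost_shift:
  fixes f :: "nat \<Rightarrow> 'a :: comm_monoid_add"
  assumes "k \<le> N" "\<And>n. n < k \<Longrightarrow> f n = 0"
  shows "(\<Sum>n = 0..N. f n) = (\<Sum>i\<le>N - k. f (k + i))"
proof -
  have "(\<Sum>n = 0..N. f n) = (\<Sum>n = k..N. f n)"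
    using assms by (intro sum.mono_neutral_right) auto
  also have "\<dots> = (\<Sum>i\<le>N - k. f (k + i))"
    using assms(1) by (intro sum.reindex_bij_witness[of _ "\<lambda>i. k + i" "\<lambda>n. n - k"]) auto
  finally show ?thesis .
qed

lemma choose_add_symmetric: "(l + i) choose l = (l + i) choose i"
  using binomial_symmetric[of l "l + i"] by simp

section \<open>Ring operations, units and residues in \<open>Zp p\<close>\<close>

section \<open>Congruences between p-integral rationals\<close>

context
  fixes p :: nat
  assumes prime_p: "prime p"
begin

lemma Zp_of_int [simp]: "of_int a \<in> Zp p"
  unfolding Zp_def by (rule CollectI, rule exI[of _ a], rule exI[of _ 1]) simp

lemma Zp_of_nat [simp]: "of_nat n \<in> Zp p"
  using Zp_of_int[of "int n"] by simp

lemma Zp_0 [simp]: "0 \<in> Zp p" and Zp_1 [simp]: "1 \<in> Zp p"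
  using Zp_of_nat[of 0] Zp_of_nat[of 1] by simp_all

lemma Zp_numeral [simp]: "numeral n \<in> Zp p"
  using Zp_of_nat[of "numeral n"] by simp

lemma Zp_add [simp]: "a \<in> Zp p \<Longrightarrow> b \<in> Zp p \<Longrightarrow> a + b \<in> Zp p"
proof -
  assume "a \<in> Zp p" "b \<in> Zp p"
  then obtain i j k l :: int where "coprime j (int p)" "j \<noteq> 0" "a = of_int i / of_int j"
    "coprime l (int p)" "l \<noteq> 0" "b = of_int k / of_int l"
    unfolding Zp_def by blast
  then show ?thesis
    unfolding Zp_def
    by (intro CollectI exI[of _ "i * l + k * j"] exI[of _ "j * l"]) (simp add: field_simps)
qed

lemma Zp_mult [simp]: "a \<in> Zp p \<Longrightarrow> b \<in> Zp p \<Longrightarrow> a * b \<in> Zp p"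
proof -
  assume "a \<in> Zp p" "b \<in> Zp p"
  then obtain i j k l :: int where "coprime j (int p)" "j \<noteq> 0" "a = of_int i / of_int j"
    "coprime l (int p)" "l \<noteq> 0" "b = of_int k / of_int l"
    unfolding Zp_def by blast
  then show ?thesis
    unfolding Zp_def
    by (intro CollectI exI[of _ "i * k"] exI[of _ "j * l"]) simp
qed

lemma Zp_uminus [simp]: "a \<in> Zp p \<Longrightarrow> - a \<in> Zp p"
  using Zp_mult[OF Zp_of_int[of "- 1"], of a] by simp

lemma Zp_diff [simp]: "a \<in> Zp p \<Longrightarrow> b \<in> Zp p \<Longrightarrow> a - b \<in> Zp p"
  using Zp_add[OF _ Zp_uminus, of a b] by simp

lemma Zp_power [simp]: "a \<in> Zp p \<Longrightarrow> a ^ n \<in> Zp p"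
  by (induction n) simp_all

lemma Zp_sum [intro]: "(\<And>i. i \<in> I \<Longrightarrow> f i \<in> Zp p) \<Longrightarrow> sum f I \<in> Zp p"
  by (induction I rule: infinite_finite_induct) auto

lemma cong_Zp_iff:
  "a \<in> Zp p \<Longrightarrow> b \<in> Zp p \<Longrightarrow> cong_Zp p a b \<longleftrightarrow> (\<exists>c\<in>Zp p. a - b = of_nat p * c)"
  by (simp add: cong_Zp_def)

lemma cong_Zp_mem: "cong_Zp p a b \<Longrightarrow> a \<in> Zp p \<and> b \<in> Zp p"
  by (simp add: cong_Zp_def)

lemma cong_Zp_refl [simp]: "a \<in> Zp p \<Longrightarrow> cong_Zp p a a"
  unfolding cong_Zp_def by (auto intro: bexI[of _ 0])

lemma cong_Zp_sym: "cong_Zp p a b \<Longrightarrow> cong_Zp p b a"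
  unfolding cong_Zp_def by (auto simp: algebra_simps intro!: bexI[of _ "- _"])

lemma cong_Zp_add: "cong_Zp p a b \<Longrightarrow> cong_Zp p c d \<Longrightarrow> cong_Zp p (a + c) (b + d)"
proof -
  assume "cong_Zp p a b" "cong_Zp p c d"
  then obtain e f where "a \<in> Zp p" "b \<in> Zp p" "c \<in> Zp p" "d \<in> Zp p" "e \<in> Zp p" "f \<in> Zp p"
    "a - b = of_nat p * e" "c - d = of_nat p * f"
    unfolding cong_Zp_def by blast
  then show ?thesis
    unfolding cong_Zp_def by (auto simp: algebra_simps intro!: bexI[of _ "e + f"])
qed

lemma cong_Zp_mult: "cong_Zp p a b \<Longrightarrow> cong_Zp p c d \<Longrightarrow> cong_Zp p (a * c) (b * d)"
proof -
  assume "cong_Zp p a b" "cong_Zp p c d"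
  then obtain e f where *: "a \<in> Zp p" "b \<in> Zp p" "c \<in> Zp p" "d \<in> Zp p" "e \<in> Zp p" "f \<in> Zp p"
    "a - b = of_nat p * e" "c - d = of_nat p * f"
    unfolding cong_Zp_def by blast
  have "a * c - b * d = (a - b) * c + b * (c - d)"
    by (simp add: algebra_simps)
  also have "\<dots> = of_nat p * (e * c + b * f)"
    using * by (simp add: algebra_simps)
  finally show ?thesis
    unfolding cong_Zp_def using * by (auto intro!: bexI[of _ "e * c + b * f"])
qed

lemma cong_Zp_trans [trans]: "cong_Zp p a b \<Longrightarrow> cong_Zp p b c \<Longrightarrow> cong_Zp p a c"
proof -
  assume *: "cong_Zp p a b" "cong_Zp p b c"
  have "cong_Zp p (a + b + - b) (b + c + - b)"
    using * by (intro cong_Zp_add) (auto dest: cong_Zp_mem)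
  then show ?thesis by simp
qed

lemma cong_Zp_power: "cong_Zp p a b \<Longrightarrow> cong_Zp p (a ^ n) (b ^ n)"
  by (induction n) (auto intro: cong_Zp_mult)

lemma cong_Zp_sum:
  "(\<And>i. i \<in> I \<Longrightarrow> cong_Zp p (f i) (g i)) \<Longrightarrow> cong_Zp p (sum f I) (sum g I)"
  by (induction I rule: infinite_finite_induct) (auto intro: cong_Zp_add)

lemma cong_Zp_prod:
  "(\<And>i. i \<in> I \<Longrightarrow> cong_Zp p (f i) (g i)) \<Longrightarrow> cong_Zp p (prod f I) (prod g I)"
  by (induction I rule: infinite_finite_induct) (auto intro: cong_Zp_mult)

lemma cong_Zp_of_int: "[a = b] (mod int p) \<Longrightarrow> cong_Zp p (of_int a) (of_int b)"
proof -
  assume "[a = b] (mod int p)"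
  then obtain k where "a - b = int p * k"
    by (meson cong_iff_dvd_diff dvdE)
  then have "rat_of_int a - rat_of_int b = of_nat p * of_int k"
    by (metis of_int_diff of_int_mult of_int_of_nat_eq)
  then show ?thesis
    unfolding cong_Zp_def by auto
qed

lemma cong_Zp_of_nat: "[a = b] (mod p) \<Longrightarrow> cong_Zp p (of_nat a) (of_nat b)"
  using cong_Zp_of_int[of "int a" "int b"] by (simp add: cong_int_iff)

lemma cong_Zp_p_0: "cong_Zp p (of_nat p) 0"
  using cong_Zp_of_nat[of p 0] by (simp add: cong_def)

text \<open>Outside the ideal the numerator is prime to \<open>p\<close>, so the fraction may be
  turned upside down.\<close>

lemma Zp_inverse: "u \<in> Zp p \<Longrightarrow> \<not> cong_Zp p u 0 \<Longrightarrow> inverse u \<in> Zp p"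
proof -
  assume u: "u \<in> Zp p" "\<not> cong_Zp p u 0"
  then obtain a b :: int where ab: "coprime b (int p)" "b \<noteq> 0" "u = of_int a / of_int b"
    unfolding Zp_def by blast
  have "\<not> int p dvd a"
  proof
    assume "int p dvd a"
    then obtain c where c: "a = int p * c" ..
    have "of_int c / of_int b \<in> Zp p"
      unfolding Zp_def using ab by blast
    moreover have "u - 0 = of_nat p * (of_int c / of_int b)"
      using ab c by simp
    ultimately show False
      using u by (auto simp: cong_Zp_iff)
  qed
  then have "coprime a (int p)" "a \<noteq> 0"
    using prime_p prime_imp_coprime[of "int p" a] by (auto simp: coprime_commute)
  moreover have "inverse u = of_int b / of_int a"
    using ab by simp
  ultimately show ?thesis
    unfolding Zp_def by blast
qed

text \<open>If u = p c had an inverse in \<open>Zp p\<close>, then 1 would be a multiple of p there,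
  and clearing denominators would make \<open>p\<close> divide a number prime to it.\<close>

lemma not_cong_Zp_0_iff:
  "u \<in> Zp p \<Longrightarrow> \<not> cong_Zp p u 0 \<longleftrightarrow> u \<noteq> 0 \<and> inverse u \<in> Zp p"
proof (intro iffI)
  assume u: "u \<in> Zp p" and "u \<noteq> 0 \<and> inverse u \<in> Zp p"
  then have u': "u \<noteq> 0" "inverse u \<in> Zp p" by auto
  show "\<not> cong_Zp p u 0"
  proof
    assume "cong_Zp p u 0"
    then obtain c where "c \<in> Zp p" "u = of_nat p * c"
      by (auto simp: cong_Zp_def)
    then have 1: "1 = of_nat p * (c * inverse u)" and 2: "c * inverse u \<in> Zp p"
      using u' by (simp_all add: mult.assoc[symmetric] del: inverse_mult_distrib)
    from 2 obtain a b :: int where ab: "coprime b (int p)" "b \<noteq> 0"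
      "c * inverse u = of_int a / of_int b"
      unfolding Zp_def by blast
    have "rat_of_int b = of_int (int p * a)"
      using 1[unfolded ab(3)] ab(2) by (simp add: field_simps)
    then have "b = int p * a"
      by (simp only: of_int_eq_iff)
    with ab have "is_unit (int p)"
      by (metis coprime_common_divisor dvd_refl dvd_triv_left)
    with prime_p show False by auto
  qed
qed (auto simp: Zp_inverse)

lemma cong_Zp_eq_diff: "a \<in> Zp p \<Longrightarrow> b \<in> Zp p \<Longrightarrow> cong_Zp p a b \<longleftrightarrow> cong_Zp p (a - b) 0"
  by (simp add: cong_Zp_iff)

text \<open>The residue is the numerator times an inverse of the denominator mod \<open>p\<close>.
  It allows passing from \<open>x\<close> to a natural number, where Clausen's identity is
  available.\<close>

lemma Zp_residue: "x \<in> Zp p \<Longrightarrow> \<exists>t<p. cong_Zp p x (of_nat t)"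
proof -
  assume x: "x \<in> Zp p"
  then obtain a b :: int where ab: "coprime b (int p)" "b \<noteq> 0" "x = of_int a / of_int b"
    unfolding Zp_def by blast
  obtain c where c: "[b * c = 1] (mod int p)"
    using ab(1) cong_solve_coprime_int by blast
  define t where "t = nat ((a * c) mod int p)"
  have p: "p > 0" using prime_p by (rule prime_gt_0_nat)
  have t: "int t = (a * c) mod int p"
    using p by (simp add: t_def)
  have "[b * int t = b * (a * c)] (mod int p)"
    unfolding t by (intro cong_mult cong_refl) (simp add: cong_def)
  also have "b * (a * c) = a * (b * c)"
    by simp
  also have "[\<dots> = a * 1] (mod int p)"
    by (intro cong_mult cong_refl c)
  finally have "int p dvd a - b * int t"
    by (simp add: cong_iff_dvd_diff dvd_diff_commute)
  then obtain d where d: "a - b * int t = int p * d" ..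
  have "of_int d / of_int b \<in> Zp p"
    unfolding Zp_def using ab by blast
  moreover have "x - of_nat t = of_nat p * (of_int d / of_int b)"
  proof -
    have "rat_of_int a - of_int b * of_nat t = of_nat p * of_int d"
      using arg_cong[OF d, of rat_of_int] by simp
    then show ?thesis using ab by (simp add: field_simps)
  qed
  ultimately have "cong_Zp p x (of_nat t)"
    using x Zp_of_nat unfolding cong_Zp_def by blast
  moreover have "t < p"
    using p unfolding t_def by (simp add: nat_less_iff)
  ultimately show ?thesis by blast
qed

lemma cong_Zp_of_nat_0D: "cong_Zp p (of_nat n) 0 \<Longrightarrow> p dvd n"
proof (rule ccontr)
  assume *: "cong_Zp p (of_nat n) 0" "\<not> p dvd n"
  then have "coprime (int n) (int p)" "n \<noteq> 0"
    using prime_p prime_imp_coprime[of p n] by (auto simp: coprime_commute intro!: Nat.gr0I)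
  then have "inverse (rat_of_nat n) \<in> Zp p"
    unfolding Zp_def by (intro CollectI exI[of _ 1] exI[of _ "int n"]) (simp add: field_simps)
  with * \<open>n \<noteq> 0\<close> show False
    using not_cong_Zp_0_iff[of "of_nat n"] by simp
qed

lemma cong_Zp_fermat: "u \<in> Zp p \<Longrightarrow> \<not> cong_Zp p u 0 \<Longrightarrow> cong_Zp p (u ^ (p - 1)) 1"
proof -
  assume u: "u \<in> Zp p" "\<not> cong_Zp p u 0"
  obtain t where t: "cong_Zp p u (of_nat t)"
    using Zp_residue u by blast
  have "\<not> p dvd t"
  proof
    assume "p dvd t"
    then have "cong_Zp p (of_nat t) 0"
      using cong_Zp_of_nat[of t 0] by (simp add: cong_0_iff)
    with t u show False using cong_Zp_trans by blast
  qed
  then have "[t ^ (p - 1) = 1] (mod p)"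
    using prime_p by (intro fermat_theorem)
  then have "cong_Zp p (of_nat t ^ (p - 1)) 1"
    using cong_Zp_of_nat by fastforce
  with cong_Zp_power[OF t] show ?thesis
    by (rule cong_Zp_trans)
qed

section \<open>Binomial coefficients and truncated binomial series modulo \<open>p\<close>\<close>

lemma Zp_inverse_fact: "k < p \<Longrightarrow> inverse (fact k) \<in> Zp p"
proof -
  assume "k < p"
  then have "\<not> p dvd fact k"
    using prime_p by (simp add: prime_dvd_fact_iff)
  then have "\<not> cong_Zp p (of_nat (fact k)) 0"
    using cong_Zp_of_nat_0D by blast
  then show ?thesis
    using Zp_inverse[OF Zp_of_nat, of "fact k"] by simp
qed

text \<open>For \<open>k < p\<close> the denominator k! is a unit, and the numerator is a product of
  factors a - i, so only the residue of \<open>a\<close> matters.\<close>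

lemma cong_Zp_gchoose:
  assumes "k < p" "cong_Zp p a b"
  shows "cong_Zp p (a gchoose k) (b gchoose k)"
proof -
  have "cong_Zp p ((\<Prod>i = 0..<k. a - of_nat i) * inverse (fact k))
          ((\<Prod>i = 0..<k. b - of_nat i) * inverse (fact k))"
    using assms cong_Zp_mem[OF assms(2)]
    by (intro cong_Zp_mult cong_Zp_prod cong_Zp_refl Zp_inverse_fact)
       (auto simp: cong_Zp_iff)
  then show ?thesis
    by (simp add: gbinomial_prod_rev divide_inverse)
qed

lemma Zp_gchoose: "k < p \<Longrightarrow> a \<in> Zp p \<Longrightarrow> a gchoose k \<in> Zp p"
  using cong_Zp_gchoose[of k a a] by (simp add: cong_Zp_def)

text \<open>Upper negation gives the argument -1 - l, which differs from p - 1 - l by p.\<close>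

lemma cong_Zp_binomial:
  assumes "l < p" "i < p"
  shows "cong_Zp p (of_nat ((l + i) choose i)) ((- 1) ^ i * of_nat ((p - 1 - l) choose i))"
proof -
  have p: "p > 0" using prime_p by (rule prime_gt_0_nat)
  have "of_nat (p - 1 - l) - (- 1 - of_nat l :: rat) = of_nat p"
    using assms p by (simp add: of_nat_diff)
  then have "cong_Zp p (- 1 - of_nat l) (of_nat (p - 1 - l))"
    using cong_Zp_p_0 cong_Zp_eq_diff[of "of_nat (p - 1 - l)" "- 1 - of_nat l"]
    by (intro cong_Zp_sym[of "of_nat (p - 1 - l)"]) simp
  then show ?thesis
    unfolding choose_add_eq_gchoose using assms
    by (auto simp: binomial_gbinomial intro!: cong_Zp_mult cong_Zp_gchoose)
qed

text \<open>Modulo \<open>p\<close> the sum is the full binomial expansion of (1 - z)^(p-1-l), and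
  Fermat removes (1 - z)^(p-1). Hence the exponent is \<open>l\<close>, not the l + 1 of the
  infinite series. \<open>N\<close> is free because N = p - 1 - k is used both with l = k and with l
  = 2k.\<close>

lemma cong_Zp_sum_binomial_power:
  assumes "l < p" "p - 1 - l \<le> N" "N < p" and z: "z \<in> Zp p" "\<not> cong_Zp p (1 - z) 0"
  shows "cong_Zp p (\<Sum>i\<le>N. of_nat ((l + i) choose i) * z ^ i) (inverse (1 - z) ^ l)"
proof -
  have u: "1 - z \<noteq> 0" "inverse (1 - z) \<in> Zp p"
    using z not_cong_Zp_0_iff[of "1 - z"] by auto
  have "cong_Zp p (\<Sum>i\<le>N. of_nat ((l + i) choose i) * z ^ i)
          (\<Sum>i\<le>N. ((- 1) ^ i * of_nat ((p - 1 - l) choose i)) * z ^ i)"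
    using assms by (intro cong_Zp_sum cong_Zp_mult cong_Zp_binomial) auto
  \<comment> \<open>Binomials with i > p - 1 - l vanish, which lowers the upper limit from
    \<open>N\<close>.\<close>
  also have "(\<Sum>i\<le>N. ((- 1) ^ i * of_nat ((p - 1 - l) choose i)) * z ^ i)
      = (\<Sum>i\<le>p - 1 - l. of_nat ((p - 1 - l) choose i) * (- z) ^ i)"
    using assms by (intro sum.mono_neutral_cong_right) (auto simp: power_minus[of z])
  also have "\<dots> = (1 - z) ^ (p - 1 - l)"
    using binomial_ring[of "- z" "1 :: rat" "p - 1 - l"] by simp
  also have "\<dots> = (1 - z) ^ (p - 1) * inverse (1 - z) ^ l"
    using assms u by (simp add: power_diff power_inverse divide_inverse)
  also have "cong_Zp p \<dots> (1 * inverse (1 - z) ^ l)"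
    using z u by (intro cong_Zp_mult cong_Zp_fermat) auto
  finally show ?thesis by simp
qed

lemma cong_Zp_sum_choose:
  assumes "k < p" and z: "z \<in> Zp p" "\<not> cong_Zp p (1 - z) 0"
  shows "cong_Zp p (\<Sum>n = 0..p-1. of_nat (n choose k) * z ^ n) ((z / (1 - z)) ^ k)"
proof -
  have "(\<Sum>n = 0..p-1. of_nat (n choose k) * z ^ n)
      = (\<Sum>i\<le>p-1-k. of_nat ((k + i) choose k) * z ^ (k + i))"
    using assms by (intro sum_atMost_shift) auto
  also have "\<dots> = z ^ k * (\<Sum>i\<le>p-1-k. of_nat ((k + i) choose i) * z ^ i)"
    using choose_add_symmetric[of k] by (simp add: sum_distrib_left power_add mult.left_commute)
  also have "cong_Zp p \<dots> (z ^ k * inverse (1 - z) ^ k)"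
    using assms by (intro cong_Zp_mult cong_Zp_sum_binomial_power) auto
  finally show ?thesis
    by (simp add: divide_inverse power_mult_distrib)
qed

text \<open>Both sides are (n+k)!/((n-k)! k!^2) for k <= n and 0 otherwise. On the right only one
  binomial depends on \<open>n\<close>, so a single series remains to be summed.\<close>

lemma choose_mult_choose_add:
  "(n choose k) * ((n + k) choose k) = ((2 * k) choose k) * ((n + k) choose (2 * k))"
proof (cases "k \<le> n")
  case True
  then show ?thesis
    using choose_mult[of k "2 * k" "n + k"] by (simp add: mult.commute mult_2)
qed (simp add: binomial_eq_0)

text \<open>The binomial series applies with l = 2k as long as 2k < p; for larger k both sides
  vanish because \<open>p\<close> divides the central binomial.\<close>

lemma cong_Zp_sum_choose_choose:
  assumes "k < p" and z: "z \<in> Zp p" "\<not> cong_Zp p (1 - z) 0"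
  shows "cong_Zp p (\<Sum>n = 0..p-1. of_nat (n choose k) * of_nat ((n + k) choose k) * z ^ n)
           (of_nat ((2 * k) choose k) * (z / (1 - z)\<^sup>2) ^ k)"
proof -
  have u: "inverse (1 - z) \<in> Zp p"
    using z not_cong_Zp_0_iff[of "1 - z"] by auto
  have eq: "(\<Sum>n = 0..p-1. of_nat (n choose k) * of_nat ((n + k) choose k) * z ^ n)
      = of_nat ((2 * k) choose k) * (\<Sum>n = 0..p-1. of_nat ((n + k) choose (2 * k)) * z ^ n)"
    unfolding of_nat_mult[symmetric] choose_mult_choose_add
    by (simp add: sum_distrib_left mult.assoc)
  show ?thesis
  proof (cases "2 * k < p")
    case True
    have "(\<Sum>n = 0..p-1. of_nat ((n + k) choose (2 * k)) * z ^ n)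
        = (\<Sum>i\<le>p-1-k. of_nat ((k + i + k) choose (2 * k)) * z ^ (k + i))"
      using assms by (intro sum_atMost_shift) auto
    also have "\<dots> = (\<Sum>i\<le>p-1-k. of_nat ((2 * k + i) choose (2 * k)) * z ^ (k + i))"
      by (simp add: mult_2 add_ac)
    also have "\<dots> = z ^ k * (\<Sum>i\<le>p-1-k. of_nat ((2 * k + i) choose i) * z ^ i)"
      using choose_add_symmetric[of "2 * k"] by (simp add: sum_distrib_left power_add mult.left_commute)
    also have "cong_Zp p \<dots> (z ^ k * inverse (1 - z) ^ (2 * k))"
      using assms True by (intro cong_Zp_mult cong_Zp_sum_binomial_power) auto
    also have "z ^ k * inverse (1 - z) ^ (2 * k) = (z / (1 - z)\<^sup>2) ^ k"
      by (simp add: divide_inverse power_mult_distrib power_mult power_inverse)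
    finally show ?thesis
      unfolding eq by (intro cong_Zp_mult) auto
  next
    case False
    have 1: "(z / (1 - z)\<^sup>2) \<in> Zp p"
      using u z by (simp add: divide_inverse power_inverse[symmetric])
    \<comment> \<open>Here k < p <= 2k, so \<open>p\<close> divides (2k)! but not k!.\<close>
    have "cong_Zp p (of_nat ((2 * k) choose k)) 0"
    proof -
      have "p dvd fact k * fact k * ((2 * k) choose k)"
        using False binomial_fact_lemma[of k "2 * k"] prime_p
        by (simp add: prime_dvd_fact_iff mult_2)
      then have "p dvd ((2 * k) choose k)"
        using prime_p assms by (simp add: prime_dvd_mult_iff prime_dvd_fact_iff)
      then show ?thesis
        using cong_Zp_of_nat[of "(2 * k) choose k" 0] by (simp add: cong_0_iff)
    qed
    then have 0: "cong_Zp p (of_nat ((2 * k) choose k) * a) 0" if "a \<in> Zp p" for a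
      using that cong_Zp_mult[of _ 0 a a] by force
    have "cong_Zp p (of_nat ((2 * k) choose k) * (\<Sum>n = 0..p-1. of_nat ((n + k) choose (2 * k)) * z ^ n)) 0"
      using z by (intro 0 Zp_sum) auto
    also have "cong_Zp p 0 (of_nat ((2 * k) choose k) * (z / (1 - z)\<^sup>2) ^ k)"
      using 1 by (intro cong_Zp_sym[OF 0]) auto
    finally show ?thesis
      unfolding eq .
  qed
qed

section \<open>The congruences for general \<open>x\<close>\<close>

theorem cong_Zp_V_G:
  assumes m: "m \<in> Zp p" "\<not> cong_Zp p m 0" "\<not> cong_Zp p m 1" and x: "x \<in> Zp p"
  shows "cong_Zp p (\<Sum>n=0..p-1. V n x / m ^ n) ((\<Sum>k=0..p-1. G k x / m ^ k)\<^sup>2)"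
    and "cong_Zp p ((\<Sum>k=0..p-1. G k x / m ^ k)\<^sup>2)
          (\<Sum>k=0..p-1. of_nat ((2*k) choose k) * (x gchoose k) * ((-1 - x) gchoose k)
             / (2 - m - 1 / m) ^ k)"
proof -
  have p: "p > 0" using prime_p by (rule prime_gt_0_nat)
  define z where "z = inverse m"
  define w where "w = inverse (m - 1)"
  define A where "A k = (- 1) ^ k * (x gchoose k) * ((- 1 - x) gchoose k)" for k
  define C where "C k = rat_of_nat ((2 * k) choose k)" for k
  have "\<not> cong_Zp p (m - 1) 0"
    using m cong_Zp_eq_diff[of m 1] by simp
  then have m0: "m \<noteq> 0" "m - 1 \<noteq> 0" "z \<in> Zp p" "w \<in> Zp p"
    using m not_cong_Zp_0_iff[of m] not_cong_Zp_0_iff[of "m - 1"]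
    by (simp_all add: z_def w_def)
  \<comment> \<open>The explicit inverse shows that 1 - z is a unit, as the truncated series
    require.\<close>
  have "1 - z \<noteq> 0" "inverse (1 - z) = m * w"
    using m0 by (auto simp: z_def w_def field_simps)
  then have z1: "\<not> cong_Zp p (1 - z) 0"
    using m0 m by (subst not_cong_Zp_0_iff) auto
  \<comment> \<open>The second common value is m/(m - 1)^2.\<close>
  have zw: "z / (1 - z) = w" "z / (1 - z)\<^sup>2 = w * (1 + w)"
    using m0 by (auto simp: z_def w_def divide_simps power2_eq_square) 
  have A: "A k \<in> Zp p" if "k < p" for k
    unfolding A_def using that x by (intro Zp_mult Zp_power Zp_gchoose) auto
  have V: "cong_Zp p (\<Sum>n=0..p-1. V n x / m ^ n) (\<Sum>k=0..p-1. A k * (C k * (w * (1 + w)) ^ k))"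
  proof -
    have "(\<Sum>n=0..p-1. V n x / m ^ n)
        = (\<Sum>n=0..p-1. (\<Sum>k=0..n. of_nat (n choose k) * of_nat ((n + k) choose k) * A k) * z ^ n)"
      by (simp add: V_def A_def z_def mult_ac divide_inverse power_inverse)
    also have "\<dots> = (\<Sum>k=0..p-1. A k *
        (\<Sum>n=0..p-1. of_nat (n choose k) * of_nat ((n + k) choose k) * z ^ n))"
      by (rule sum_binomial_transform)
    also have "cong_Zp p \<dots> (\<Sum>k=0..p-1. A k * (C k * (z / (1 - z)\<^sup>2) ^ k))"
      unfolding C_def using p m0 z1 A
      by (intro cong_Zp_sum cong_Zp_mult cong_Zp_sum_choose_choose cong_Zp_refl) auto
    finally show ?thesis unfolding zw .
  qed
  have G: "cong_Zp p (\<Sum>n=0..p-1. G n x / m ^ n) (\<Sum>k=0..p-1. A k * w ^ k)"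
  proof -
    have "(\<Sum>n=0..p-1. G n x / m ^ n)
        = (\<Sum>n=0..p-1. (\<Sum>k=0..n. of_nat (n choose k) * 1 * A k) * z ^ n)"
      by (simp add: G_def A_def z_def mult_ac divide_inverse power_inverse)
    also have "\<dots> = (\<Sum>k=0..p-1. A k * (\<Sum>n=0..p-1. of_nat (n choose k) * 1 * z ^ n))"
      by (rule sum_binomial_transform)
    also have "cong_Zp p \<dots> (\<Sum>k=0..p-1. A k * (z / (1 - z)) ^ k)"
      unfolding mult_1_right using p m0 z1 A
      by (intro cong_Zp_sum cong_Zp_mult cong_Zp_sum_choose cong_Zp_refl) auto
    finally show ?thesis unfolding zw .
  qed
  obtain t where t: "t < p" "cong_Zp p x (of_nat t)"
    using Zp_residue[OF x] by blast
  have At: "cong_Zp p (A k) (legendre_coeff t k)" if "k < p" for k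
  proof -
    have "cong_Zp p (- 1 + - 1 * x) (- 1 + - 1 * of_nat t)"
      using t by (intro cong_Zp_add cong_Zp_mult cong_Zp_refl) auto
    then show ?thesis
      unfolding A_def legendre_coeff_eq_gchoose using that t
      by (intro cong_Zp_mult cong_Zp_gchoose cong_Zp_refl) auto
  qed
  \<comment> \<open>The coefficients vanish beyond t <= p - 1, so Clausen's identity with n = t
    covers the whole range.\<close>
  have upto: "(\<Sum>k=0..p-1. legendre_coeff t k * f k) = (\<Sum>k\<le>t. legendre_coeff t k * f k)" for f
    using t by (intro sum.mono_neutral_right) (auto simp: legendre_coeff_def)
  have "cong_Zp p ((\<Sum>k=0..p-1. A k * w ^ k)\<^sup>2) ((\<Sum>k=0..p-1. legendre_coeff t k * w ^ k)\<^sup>2)"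
    using At m0 p by (intro cong_Zp_power cong_Zp_sum cong_Zp_mult cong_Zp_refl) auto
  also have "(\<Sum>k=0..p-1. legendre_coeff t k * w ^ k)\<^sup>2 = (\<Sum>k=0..p-1. legendre_coeff t k * (C k * (w * (1 + w)) ^ k))"
    unfolding upto legendre_clausen by (simp add: C_def mult_ac)
  \<comment> \<open>Returning from \<open>t\<close> to \<open>x\<close> gives the very sum obtained
    from \<open>V\<close>.\<close>
  also have "cong_Zp p \<dots> (\<Sum>k=0..p-1. A k * (C k * (w * (1 + w)) ^ k))"
    unfolding C_def using At m0 p
    by (intro cong_Zp_sum cong_Zp_mult cong_Zp_refl cong_Zp_sym[OF At]) auto
  finally have GC: "cong_Zp p ((\<Sum>k=0..p-1. G k x / m ^ k)\<^sup>2)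
      (\<Sum>k=0..p-1. A k * (C k * (w * (1 + w)) ^ k))"
    using cong_Zp_trans[OF cong_Zp_power[OF G]] by blast
  show "cong_Zp p (\<Sum>n=0..p-1. V n x / m ^ n) ((\<Sum>k=0..p-1. G k x / m ^ k)\<^sup>2)"
    by (rule cong_Zp_trans[OF V cong_Zp_sym[OF GC]])
  \<comment> \<open>Both sides are -(m - 1)^2/m; the minus sign yields the factor (-1)^k contained
    in \<open>A k\<close>.\<close>
  have "2 - m - 1 / m = - inverse (w * (1 + w))"
    using m0 by (auto simp: w_def divide_simps) (simp add: algebra_simps)
  then have "inverse (2 - m - 1 / m) = - (w * (1 + w))"
    by simp
  then have inv: "inverse ((2 - m - 1 / m) ^ k) = (- 1) ^ k * (w * (1 + w)) ^ k" for k
    unfolding power_inverse[symmetric] by (simp only: power_minus[of "w * (1 + w)"])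
  then have "(\<Sum>k=0..p-1. of_nat ((2*k) choose k) * (x gchoose k) * ((-1 - x) gchoose k)
             / (2 - m - 1 / m) ^ k) = (\<Sum>k=0..p-1. A k * (C k * (w * (1 + w)) ^ k))"
    unfolding divide_inverse[of _ "_ ^ _"] inv
    by (intro sum.cong refl) (simp only: A_def C_def mult_ac)
  with GC show "cong_Zp p ((\<Sum>k=0..p-1. G k x / m ^ k)\<^sup>2)
          (\<Sum>k=0..p-1. of_nat ((2*k) choose k) * (x gchoose k) * ((-1 - x) gchoose k)
             / (2 - m - 1 / m) ^ k)"
    by simp
qed

text \<open>The general result is applied to m' = m/c: then c^n/m^n = 1/m'^n and 2 - m' - 1/m' = (2c
  - m - c^2/m)/c. The factor c^k freed in the last sum completes the integer \<open>N k\<close>.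
  Keeping \<open>a\<close>, \<open>b\<close> and \<open>N\<close> as parameters lets the concrete
  numerals be inserted directly.\<close>

corollary cong_Zp_Vr_Gr:
  fixes r :: nat
  defines "c \<equiv> c_of r" and "x \<equiv> - 1 / of_nat r"
  assumes m: "m \<in> Zp p" "\<not> cong_Zp p m 0" "\<not> cong_Zp p m c"
    and x: "x \<in> Zp p" and c: "c \<in> Zp p" "inverse c \<in> Zp p" "c \<noteq> 0"
    and a: "a = 2 * c" and b: "b = c\<^sup>2"
    and N: "\<And>k. of_nat ((2 * k) choose k) * (c ^ k * (x gchoose k) * ((- 1 - x) gchoose k)) = of_nat (N k)"
  shows "cong_Zp p (\<Sum>n=0..p-1. Vr r n / m ^ n) ((\<Sum>k=0..p-1. Gr r k / m ^ k)\<^sup>2)"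
    and "cong_Zp p ((\<Sum>k=0..p-1. Gr r k / m ^ k)\<^sup>2)
      (\<Sum>k=0..p-1. of_nat (N k) / (a - m - b / m) ^ k)"
proof -
  define m' where "m' = m * inverse c"
  have m': "m' \<in> Zp p"
    using m c by (simp add: m'_def)
  \<comment> \<open>Used for y = 0 and y = 1, to carry the conditions on \<open>m\<close> over to
    \<open>m'\<close>.\<close>
  have "\<not> cong_Zp p m' y" if "\<not> cong_Zp p m (y * c)" for y
  proof
    assume "cong_Zp p m' y"
    then have "cong_Zp p (m' * c) (y * c)"
      using c by (intro cong_Zp_mult cong_Zp_refl)
    with that c show False by (simp add: m'_def mult.assoc)
  qed
  from this[of 0] this[of 1] have "\<not> cong_Zp p m' 0" "\<not> cong_Zp p m' 1"
    using m by simp_all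
  note main = cong_Zp_V_G[OF m' this x]
  have m0: "m \<noteq> 0"
    using m not_cong_Zp_0_iff by blast
  have "2 - m' - 1 / m' = (a - m - b / m) / c"
    using m0 c by (simp add: m'_def a b field_simps power2_eq_square)
  then have 1: "of_nat ((2*k) choose k) * (x gchoose k) * ((-1 - x) gchoose k) / (2 - m' - 1 / m') ^ k
      = of_nat (N k) / (a - m - b / m) ^ k" for k
    using N[of k, symmetric] by (simp add: power_divide mult_ac)
  have scale: "y / m' ^ k = c ^ k * y / m ^ k" for y k
    using c by (simp add: m'_def power_mult_distrib power_inverse field_simps)
  have 2: "V n x / m' ^ n = Vr r n / m ^ n" "G n x / m' ^ n = Gr r n / m ^ n" for n
    unfolding scale by (simp_all add: Vr_def Gr_def c_def x_def)
  show "cong_Zp p (\<Sum>n=0..p-1. Vr r n / m ^ n) ((\<Sum>k=0..p-1. Gr r k / m ^ k)\<^sup>2)"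
    and "cong_Zp p ((\<Sum>k=0..p-1. Gr r k / m ^ k)\<^sup>2)
      (\<Sum>k=0..p-1. of_nat (N k) / (a - m - b / m) ^ k)"
    using main unfolding 1 2 by blast+
qed

end

theorem theorem4p8:
  fixes p :: nat
  assumes "prime p" and "p > 3"
  shows "(\<forall>m\<in>Zp p. \<forall>x\<in>Zp p.
     \<not> cong_Zp p m 0 \<and> \<not> cong_Zp p m 1 \<and> \<not> cong_Zp p m (- 1) \<longrightarrow>
        cong_Zp p (\<Sum>n=0..p-1. V n x / m ^ n) ((\<Sum>k=0..p-1. G k x / m ^ k)\<^sup>2) \<and>
        cong_Zp p ((\<Sum>k=0..p-1. G k x / m ^ k)\<^sup>2)
          (\<Sum>k=0..p-1. of_nat ((2*k) choose k) * (x gchoose k) * ((-1 - x) gchoose k)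
             / (2 - m - 1 / m) ^ k))
   \<and> (\<forall>m\<in>Zp p. \<not> cong_Zp p m 0 \<longrightarrow>
     (\<not> cong_Zp p m 27 \<and> \<not> cong_Zp p m (- 27) \<longrightarrow>
        cong_Zp p (\<Sum>n=0..p-1. Vr 3 n / m ^ n) ((\<Sum>k=0..p-1. Gr 3 k / m ^ k)\<^sup>2) \<and>
        cong_Zp p ((\<Sum>k=0..p-1. Gr 3 k / m ^ k)\<^sup>2)
          (\<Sum>k=0..p-1. of_nat (((2*k) choose k)^2 * ((3*k) choose k)) / (54 - m - 729 / m) ^ k)) \<and>
     (\<not> cong_Zp p m 64 \<and> \<not> cong_Zp p m (- 64) \<longrightarrow>
        cong_Zp p (\<Sum>n=0..p-1. Vr 4 n / m ^ n) ((\<Sum>k=0..p-1. Gr 4 k / m ^ k)\<^sup>2) \<and>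
        cong_Zp p ((\<Sum>k=0..p-1. Gr 4 k / m ^ k)\<^sup>2)
          (\<Sum>k=0..p-1. of_nat (((2*k) choose k)^2 * ((4*k) choose (2*k))) / (128 - m - 4096 / m) ^ k)) \<and>
     (\<not> cong_Zp p m 432 \<and> \<not> cong_Zp p m (- 432) \<longrightarrow>
        cong_Zp p (\<Sum>n=0..p-1. Vr 6 n / m ^ n) ((\<Sum>k=0..p-1. Gr 6 k / m ^ k)\<^sup>2) \<and>
        cong_Zp p ((\<Sum>k=0..p-1. Gr 6 k / m ^ k)\<^sup>2)
          (\<Sum>k=0..p-1. of_nat (((2*k) choose k) * ((3*k) choose k) * ((6*k) choose (3*k))) / (864 - m - 186624 / m) ^ k)))"
proof -
  note prime = assms(1)
  \<comment> \<open>This is where \<open>p > 3\<close> enters: it makes 2 and 3 units.\<close>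
  have small: "\<not> p dvd 2" "\<not> p dvd 3"
    using assms(2) by (auto dest: dvd_imp_le)
  then have inv: "inverse 2 \<in> Zp p" "inverse 3 \<in> Zp p"
    using Zp_inverse[OF prime, of 2] Zp_inverse[OF prime, of 3]
      cong_Zp_of_nat_0D[OF prime, of 2] cong_Zp_of_nat_0D[OF prime, of 3] prime
    by auto
  \<comment> \<open>All denominators that occur are of the form 2^i 3^j: 3, 4, 6, and 27 = 3^3, 64 =
    2^6, 432 = 2^4 * 3^3.\<close>
  have pow: "inverse 2 ^ i * inverse 3 ^ j \<in> Zp p" for i j
    using inv prime by simp
  have x: "- 1 / of_nat 3 \<in> Zp p" "- 1 / of_nat 4 \<in> Zp p" "- 1 / of_nat 6 \<in> Zp p"
    using Zp_uminus[OF prime pow[of 0 1]] Zp_uminus[OF prime pow[of 2 0]]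
      Zp_uminus[OF prime pow[of 1 1]]
    by (simp_all add: power2_eq_square)
  have c: "c_of 3 \<in> Zp p" "c_of 4 \<in> Zp p" "c_of 6 \<in> Zp p"
    using prime by (simp_all add: c_of_def)
  have inv_c: "inverse (c_of 3) \<in> Zp p" "inverse (c_of 4) \<in> Zp p" "inverse (c_of 6) \<in> Zp p"
    using pow[of 0 3] pow[of 6 0] pow[of 4 3] by (simp_all add: c_of_def field_simps)
  have c0: "c_of 3 \<noteq> 0" "c_of 4 \<noteq> 0" "c_of 6 \<noteq> 0"
    by (simp_all add: c_of_def)
  have a: "54 = 2 * c_of 3" "128 = 2 * c_of 4" "864 = 2 * c_of 6"
    and b: "729 = (c_of 3)\<^sup>2" "4096 = (c_of 4)\<^sup>2" "186624 = (c_of 6)\<^sup>2"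
    by (simp_all add: c_of_def)
  have N3: "of_nat ((2 * k) choose k) *
      (c_of 3 ^ k * ((- 1 / of_nat 3) gchoose k) * ((- 1 - (- 1 / of_nat 3)) gchoose k))
      = of_nat (((2*k) choose k)^2 * ((3*k) choose k))" for k
    using gchoose_product_3[of k] by (simp add: c_of_def power2_eq_square mult.assoc)
  have N4: "of_nat ((2 * k) choose k) *
      (c_of 4 ^ k * ((- 1 / of_nat 4) gchoose k) * ((- 1 - (- 1 / of_nat 4)) gchoose k))
      = of_nat (((2*k) choose k)^2 * ((4*k) choose (2*k)))" for k
    using gchoose_product_4[of k] by (simp add: c_of_def power2_eq_square mult.assoc)
  have N6: "of_nat ((2 * k) choose k) *
      (c_of 6 ^ k * ((- 1 / of_nat 6) gchoose k) * ((- 1 - (- 1 / of_nat 6)) gchoose k))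
      = of_nat (((2*k) choose k) * ((3*k) choose k) * ((6*k) choose (3*k)))" for k
    using gchoose_product_6[of k] by (simp add: c_of_def mult.assoc)
  note r3 = cong_Zp_Vr_Gr[OF prime _ _ _ x(1) c(1) inv_c(1) c0(1) a(1) b(1) N3]
  note r4 = cong_Zp_Vr_Gr[OF prime _ _ _ x(2) c(2) inv_c(2) c0(2) a(2) b(2) N4]
  note r6 = cong_Zp_Vr_Gr[OF prime _ _ _ x(3) c(3) inv_c(3) c0(3) a(3) b(3) N6]
  show ?thesis
  proof (intro conjI ballI impI, goal_cases)
    case (1 m x)
    then show ?case by (intro cong_Zp_V_G(1)[OF prime]) auto
  next
    case (2 m x)
    then show ?case by (intro cong_Zp_V_G(2)[OF prime]) auto
  next
    case (3 m)
    then show ?case by (intro r3(1)) (auto simp: c_of_def)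
  next
    case (4 m)
    then show ?case by (intro r3(2)) (auto simp: c_of_def)
  next
    case (5 m)
    then show ?case by (intro r4(1)) (auto simp: c_of_def)
  next
    case (6 m)
    then show ?case by (intro r4(2)) (auto simp: c_of_def)
  next
    case (7 m)
    then show ?case by (intro r6(1)) (auto simp: c_of_def)
  next
    case (8 m)
    then show ?case by (intro r6(2)) (auto simp: c_of_def)
  qed
qed

end
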